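(* Let $\theta\in[\frac12,1]$, let $0=t_0<\dots<t_K=T$ be a uniform time grid with step $\Delta t=t_{k+1}-t_k$, and for $1\le i\le n$, $1\le j\le m$ let $(u^i_k)_{0\le k\le K-1}$ and $(v^j_k)_{0\le k\le K-1}$ be real numbers. Let $(\beta^i_k)$, $(\gamma^j_k)$ and $(r_k)$ be the solutions of, for $0\le k<K$, $$\frac{\beta^i_{k+1}-\beta^i_k}{\Delta t}-(A+C)(\theta\beta^i_{k+1}+(1-\theta)\beta^i_k)=0,\qquad (I+\Delta t(1-\theta)(A+C))\beta^i_0=-C\psi^i,$$ $$\frac{\gamma^j_{k+1}-\gamma^j_k}{\Delta t}-(A+C)(\theta\gamma^j_{k+1}+(1-\theta)\gamma^j_k)=0,\qquad (I+\Delta t(1-\theta)(A+C))\gamma^j_0=-c_j,$$ $$\frac{r_{k+1}-r_k}{\Delta t}-(A+C)(\theta r_{k+1}+(1-\theta)r_k)=N(\bar y),\qquad r_0=0.$$ Then the second simplified Newton step $(d^{(2)}_k)$ for the $\theta$-scheme, i.e. the solution of $$\frac{d^{(2)}_{k+1}-d^{(2)}_k}{\Delta t}-(A+C)(\theta d^{(2)}_{k+1}+(1-\theta)d^{(2)}_k)=N(\bar y)-\sum_{i=1}^nu^i_kC\psi^i-\sum_{j=1}^mv^j_kc_j\quad(0\le k<K),\qquad d^{(2)}_0=0,$$ can be represented by the discrete convolution formula $$d^{(2)}_k=r_k+\Delta t\sum_{i=1}^n\sum_{\ell=0}^{k-1}\beta^i_{k-\ell}u^i_\ell+\Delta t\sum_{j=1}^m\sum_{\ell=0}^{k-1}\gamma^j_{k-\ell}v^j_\ell,$$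 where the sums over $\ell$ vanish for $k=0$. Consequently, $$d^{(2)}_k-r_k\in\operatorname{span}\Big\{\bigcup_{i=1}^n\{\beta^i_1,\dots,\beta^i_k\}\cup\bigcup_{j=1}^m\{\gamma^j_1,\dots,\gamma^j_k\}\Big\}.$$
   Context: Setting: $T>0$; $V\hookrightarrow W\hookrightarrow H$ are real Hilbert spaces with dense continuous embeddings; $y_0\in W$, $F\in H$, $U=L^2(0,T)$. $Y,Z$ are Banach spaces with $Y\hookrightarrow L^2(0,T;V)\cap C([0,T],H)$ and $Z\hookrightarrow L^2(0,T;H)\times W$ (boundary conditions are included in the definition of $Y$). $A$ is a linear spatial operator, $N$ a nonlinear term (the superposition operator of a polynomial), and $E:Y\times U\to Z$, $E(y,u)=(\partial_t y-Ay+N(y)-Fu,\;y(0)-y_0)$ is continuously Fréchet differentiable with $E_y(y,u)\in\mathcal L(Y,Z)$ invertible for all $(y,u)$. For every time-independent $\bar y\in Y$ the operator $A-N_y(\bar y)$ generates a strongly continuous semigroup on $H$. A linearization point $\bar y\in Y$, constant in time, $\bar y(t)=\bar y_0$ with $\bar y_0\in V$, is fixed, and $C:=-N_y(\bar y)$. $\psi^1,\dots,\psi^n\in W$ are orthonormal in $W$ and $c_1,\dots,c_m\in H$ are orthonormal in $H$. The numbers $u^i_k$, $v^j_k$ are interval-wise constant discretizations of the coefficient functions $u^i$, $v^j$ in the expansions $\sum_iu^i(t)\psi^i$ of the reduced first Newton step and $\sum_jv^j(t)c_j$ of the nonlinearity $N$ evaluated at the reduced first Newton iterate. The time-discrete problem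 for $(d^{(2)}_k)$ is understood to determine its solution uniquely. *)

theory Defs
  imports "HOL-Analysis.Analysis" "HOL-Computational_Algebra.Polynomial"
begin

section \<open>Spaces\<close>

text \<open>Hilbert spaces are types, and \<open>V \<hookrightarrow> W \<hookrightarrow> H\<close> is given by explicit embedding maps.\<close>

definition dense_embedding :: "('a::real_normed_vector \<Rightarrow> 'b::real_normed_vector) \<Rightarrow> bool" where
  "dense_embedding \<iota> \<longleftrightarrow> bounded_linear \<iota> \<and> inj \<iota> \<and> closure (range \<iota>) = UNIV"

text \<open>Bochner measurability is spelled out because the library's Bochner integral is restricted to
  second countable spaces, while the Hilbert spaces here need not be separable.\<close>

definition strongly_measurable :: "'x measure \<Rightarrow> ('x \<Rightarrow> 'a::real_normed_vector) \<Rightarrow> bool" where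
  "strongly_measurable M f \<longleftrightarrow>
     (\<exists>s. (\<forall>n. simple_function M (s n)) \<and> (AE x in M. (\<lambda>n. s n x) \<longlonglongrightarrow> f x))"

definition in_L2 :: "real \<Rightarrow> (real \<Rightarrow> 'a::real_normed_vector) \<Rightarrow> bool" where
  "in_L2 T f \<longleftrightarrow> strongly_measurable (lebesgue_on {0..T}) f \<and>
     integrable (lebesgue_on {0..T}) (\<lambda>t. (norm (f t))\<^sup>2)"

definition L2_norm :: "real \<Rightarrow> (real \<Rightarrow> 'a::real_normed_vector) \<Rightarrow> real" where
  "L2_norm T f = sqrt (LINT t|lebesgue_on {0..T}. (norm (f t))\<^sup>2)"

text \<open>The weak derivative of \<open>y\<close> on \<open>(0,T)\<close> is the locally Bochner integrable \<open>g\<close>. Testing with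
  \<open>\<phi>(t) h\<close>, where \<open>h\<close> runs through the Hilbert space, is equivalent to the identity between
  the vector-valued integrals.\<close>

definition test_function :: "real \<Rightarrow> (real \<Rightarrow> real) \<Rightarrow> bool" where
  "test_function T \<phi> \<longleftrightarrow> (\<forall>k. ((deriv ^^ k) \<phi>) differentiable_on UNIV) \<and>
     (\<exists>a b. 0 < a \<and> b < T \<and> (\<forall>t. t \<notin> {a..b} \<longrightarrow> \<phi> t = 0))"

definition weak_time_deriv :: "real \<Rightarrow> (real \<Rightarrow> 'h::real_inner) \<Rightarrow> (real \<Rightarrow> 'h) \<Rightarrow> bool" where
  "weak_time_deriv T y g \<longleftrightarrow>
     strongly_measurable (lebesgue_on {0..T}) g \<and>
     (\<forall>a b. 0 < a \<longrightarrow> b < T \<longrightarrow> integrable (lebesgue_on {a..b}) (\<lambda>t. norm (g t))) \<and>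
     (\<forall>\<phi> h. test_function T \<phi> \<longrightarrow>
        (LINT t|lebesgue_on {0..T}. deriv \<phi> t * (y t \<bullet> h)) =
        - (LINT t|lebesgue_on {0..T}. \<phi> t * (g t \<bullet> h)))"

section \<open>Operators\<close>

text \<open>Unbounded operators on \<open>H\<close> are pairs of a domain and a function that is only meaningful
  on that domain.\<close>

definition linear_operator :: "'h::real_vector set \<Rightarrow> ('h \<Rightarrow> 'h) \<Rightarrow> bool" where
  "linear_operator D B \<longleftrightarrow> subspace D \<and>
     (\<forall>x\<in>D. \<forall>y\<in>D. \<forall>a b. B (a *\<^sub>R x + b *\<^sub>R y) = a *\<^sub>R B x + b *\<^sub>R B y)"

definition C0_semigroup :: "(real \<Rightarrow> 'h::real_normed_vector \<Rightarrow>\<^sub>L 'h) \<Rightarrow> bool" where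
  "C0_semigroup S \<longleftrightarrow> S 0 = id_blinfun \<and>
     (\<forall>s\<ge>0. \<forall>t\<ge>0. S (s + t) = S s o\<^sub>L S t) \<and>
     (\<forall>x. continuous_on {0..} (\<lambda>t. blinfun_apply (S t) x))"

definition generates_C0_semigroup :: "'h::real_normed_vector set \<Rightarrow> ('h \<Rightarrow> 'h) \<Rightarrow> bool" where
  "generates_C0_semigroup D B \<longleftrightarrow> (\<exists>S. C0_semigroup S \<and>
     (\<forall>x l. (x \<in> D \<and> B x = l) \<longleftrightarrow>
        ((\<lambda>t. (blinfun_apply (S t) x - x) /\<^sub>R t) \<longlongrightarrow> l) (at_right 0)))"

text \<open>A superposition operator presupposes that the elements of \<open>H\<close> are (classes of) functions
  on a spatial domain: \<open>\<rho> h\<close> is a representative of \<open>h\<close>.\<close>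

definition function_space :: "'x measure \<Rightarrow> ('h::real_vector \<Rightarrow> 'x \<Rightarrow> real) \<Rightarrow> bool" where
  "function_space \<Omega> \<rho> \<longleftrightarrow> (\<forall>h. \<rho> h \<in> borel_measurable \<Omega>) \<and>
     (\<forall>a b g h. AE x in \<Omega>. \<rho> (a *\<^sub>R g + b *\<^sub>R h) x = a * \<rho> g x + b * \<rho> h x) \<and>
     (\<forall>g h. (AE x in \<Omega>. \<rho> g x = \<rho> h x) \<longrightarrow> g = h)"

text \<open>\<open>N(h) = p \<circ> h\<close>, defined for those \<open>h\<close> for which the composition again represents an
  element of \<open>H\<close>, and its derivative \<open>N_y(q) h = p'(q) h\<close>.\<close>

definition superposition_dom ::
  "'x measure \<Rightarrow> ('h \<Rightarrow> 'x \<Rightarrow> real) \<Rightarrow> real poly \<Rightarrow> 'h set" where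
  "superposition_dom \<Omega> \<rho> p = {h. \<exists>g. AE x in \<Omega>. \<rho> g x = poly p (\<rho> h x)}"

definition superposition ::
  "'x measure \<Rightarrow> ('h \<Rightarrow> 'x \<Rightarrow> real) \<Rightarrow> real poly \<Rightarrow> 'h \<Rightarrow> 'h" where
  "superposition \<Omega> \<rho> p h = (THE g. AE x in \<Omega>. \<rho> g x = poly p (\<rho> h x))"

definition superposition_deriv_dom ::
  "'x measure \<Rightarrow> ('h \<Rightarrow> 'x \<Rightarrow> real) \<Rightarrow> real poly \<Rightarrow> 'h \<Rightarrow> 'h set" where
  "superposition_deriv_dom \<Omega> \<rho> p q =
     {h. \<exists>g. AE x in \<Omega>. \<rho> g x = poly (pderiv p) (\<rho> q x) * \<rho> h x}"

definition superposition_deriv ::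
  "'x measure \<Rightarrow> ('h \<Rightarrow> 'x \<Rightarrow> real) \<Rightarrow> real poly \<Rightarrow> 'h \<Rightarrow> 'h \<Rightarrow> 'h" where
  "superposition_deriv \<Omega> \<rho> p q h =
     (THE g. AE x in \<Omega>. \<rho> g x = poly (pderiv p) (\<rho> q x) * \<rho> h x)"

section \<open>The state equation\<close>

definition continuously_Frechet_differentiable ::
  "('a::real_normed_vector \<Rightarrow> 'b::real_normed_vector) \<Rightarrow> bool" where
  "continuously_Frechet_differentiable f \<longleftrightarrow>
     (\<exists>f'. (\<forall>x. (f has_derivative blinfun_apply (f' x)) (at x)) \<and> continuous_on UNIV f')"

definition partial_y ::
  "('y::real_normed_vector \<times> 'u \<Rightarrow> 'z::real_normed_vector) \<Rightarrow> 'y \<Rightarrow> 'u \<Rightarrow> 'y \<Rightarrow> 'z" where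
  "partial_y E y u = frechet_derivative (\<lambda>y. E (y, u)) (at y)"

text \<open>
  \<^item> \<open>tr y t\<close> is the value \<open>y(t) \<in> H\<close> of \<open>y \<in> Y\<close>, which encodes
    \<open>Y \<hookrightarrow> L\<^sup>2(0,T;V) \<inter> C([0,T],H)\<close>;
  \<^item> \<open>zL\<close> and \<open>zW\<close> are the components of \<open>Z \<hookrightarrow> L\<^sup>2(0,T;H) \<times> W\<close>;
  \<^item> \<open>uL\<close> identifies \<open>U\<close> isometrically with \<open>L\<^sup>2(0,T)\<close>.

  Elements of \<open>L\<^sup>2\<close> are given by representatives, so identities for \<open>zL\<close> and \<open>uL\<close> hold almost
  everywhere. The last two assumptions fix \<open>E\<close> and express that \<open>N_y\<close> is the derivative of \<open>N\<close>,
  that is \<open>E_y(y,u)\<delta> = (\<partial>\<^sub>t\<delta> - A\<delta> + N_y(y)\<delta>, \<delta>(0))\<close>.\<close>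

locale newton_setting =
  fixes T :: real
    and iVW :: "'v::{real_inner, complete_space} \<Rightarrow> 'w::{real_inner, complete_space}"
    and iWH :: "'w \<Rightarrow> 'h::{real_inner, complete_space}"
    and \<Omega> :: "'x measure" and \<rho> :: "'h \<Rightarrow> 'x \<Rightarrow> real"
    and domA :: "'h set" and A :: "'h \<Rightarrow> 'h"
    and p :: "real poly"
    and y0 :: 'w and F :: 'h
    and tr :: "'y::banach \<Rightarrow> real \<Rightarrow> 'h"
    and uL :: "'u::{real_inner, complete_space} \<Rightarrow> real \<Rightarrow> real"
    and zL :: "'z::banach \<Rightarrow> real \<Rightarrow> 'h" and zW :: "'z \<Rightarrow> 'w"
    and E :: "'y \<times> 'u \<Rightarrow> 'z"
  assumes T_pos: "0 < T"
    and embed_VW: "dense_embedding iVW" and embed_WH: "dense_embedding iWH"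
    and H_functions: "function_space \<Omega> \<rho>"
    and A_linear: "linear_operator domA A"
    and Y_cont: "\<And>y. continuous_on {0..T} (tr y)"
    and Y_linear: "\<And>a b y y' t. t \<in> {0..T} \<Longrightarrow>
           tr (a *\<^sub>R y + b *\<^sub>R y') t = a *\<^sub>R tr y t + b *\<^sub>R tr y' t"
    and Y_inj: "\<And>y y'. \<forall>t\<in>{0..T}. tr y t = tr y' t \<Longrightarrow> y = y'"
    and Y_bounded: "\<exists>c. \<forall>y. (\<forall>t\<in>{0..T}. norm (tr y t) \<le> c * norm y) \<and>
           (\<exists>v::real \<Rightarrow> 'v. in_L2 T v \<and> L2_norm T v \<le> c * norm y \<and>
              (AE t in lebesgue_on {0..T}. iWH (iVW (v t)) = tr y t))"
    and U_L2: "\<And>u. in_L2 T (uL u)"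
    and U_linear: "\<And>a b u u'. AE t in lebesgue_on {0..T}.
           uL (a *\<^sub>R u + b *\<^sub>R u') t = a * uL u t + b * uL u' t"
    and U_isometric: "\<And>u. L2_norm T (uL u) = norm u"
    and U_surj: "\<And>f. in_L2 T f \<Longrightarrow> \<exists>u. AE t in lebesgue_on {0..T}. uL u t = f t"
    and Z_L2: "\<And>z. in_L2 T (zL z)"
    and Z_linear: "\<And>a b z z'. AE t in lebesgue_on {0..T}.
           zL (a *\<^sub>R z + b *\<^sub>R z') t = a *\<^sub>R zL z t + b *\<^sub>R zL z' t"
    and Z_W: "bounded_linear zW"
    and Z_inj: "\<And>z z'. \<lbrakk>AE t in lebesgue_on {0..T}. zL z t = zL z' t; zW z = zW z'\<rbrakk> \<Longrightarrow> z = z'"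
    and Z_bounded: "\<exists>c. \<forall>z. L2_norm T (zL z) \<le> c * norm z"
    and E_C1: "continuously_Frechet_differentiable E"
    and E_y_invertible: "\<And>y u. bounded_linear (partial_y E y u) \<and>
           (\<exists>G. bounded_linear G \<and> G \<circ> partial_y E y u = id \<and> partial_y E y u \<circ> G = id)"
    and generator: "\<And>y h. \<forall>t\<in>{0..T}. tr y t = h \<Longrightarrow>
           generates_C0_semigroup (domA \<inter> superposition_deriv_dom \<Omega> \<rho> p h)
             (\<lambda>x. A x - superposition_deriv \<Omega> \<rho> p h x)"
    and E_eq: "\<And>y u. \<exists>g. weak_time_deriv T (tr y) g \<and>
           (AE t in lebesgue_on {0..T}. tr y t \<in> domA \<inter> superposition_dom \<Omega> \<rho> p \<and>
              zL (E (y, u)) t = g t - A (tr y t) + superposition \<Omega> \<rho> p (tr y t) - uL u t *\<^sub>R F) \<and>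
           iWH (zW (E (y, u))) = tr y 0 - iWH y0"
    and E_y_eq: "\<And>y u \<delta>. \<exists>g. weak_time_deriv T (tr \<delta>) g \<and>
           (AE t in lebesgue_on {0..T}.
              tr \<delta> t \<in> domA \<inter> superposition_deriv_dom \<Omega> \<rho> p (tr y t) \<and>
              zL (partial_y E y u \<delta>) t =
                g t - A (tr \<delta> t) + superposition_deriv \<Omega> \<rho> p (tr y t) (tr \<delta> t)) \<and>
           iWH (zW (partial_y E y u \<delta>)) = tr \<delta> 0"

section \<open>The time-discrete problems\<close>

definition orthonormal_upto :: "nat \<Rightarrow> (nat \<Rightarrow> 'a::real_inner) \<Rightarrow> bool" where
  "orthonormal_upto n e \<longleftrightarrow> (\<forall>i\<in>{1..n}. \<forall>j\<in>{1..n}. e i \<bullet> e j = (if i = j then 1 else 0))"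

text \<open>The combination \<open>\<theta> x\<^sub>k\<^sub>+\<^sub>1 + (1 - \<theta>) x\<^sub>k\<close> has to lie in the domain of \<open>B\<close>, and not
  \<open>x\<^sub>k\<close> and \<open>x\<^sub>k\<^sub>+\<^sub>1\<close> individually: for \<open>\<theta> = 1\<close> the initial value need not lie in the domain.\<close>

definition theta_scheme ::
  "real \<Rightarrow> real \<Rightarrow> nat \<Rightarrow> 'h::real_vector set \<Rightarrow> ('h \<Rightarrow> 'h) \<Rightarrow> (nat \<Rightarrow> 'h) \<Rightarrow> (nat \<Rightarrow> 'h) \<Rightarrow> bool" where
  "theta_scheme \<theta> dt K D B f x \<longleftrightarrow> (\<forall>k<K.
     \<theta> *\<^sub>R x (Suc k) + (1 - \<theta>) *\<^sub>R x k \<in> D \<and>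
     (x (Suc k) - x k) /\<^sub>R dt - B (\<theta> *\<^sub>R x (Suc k) + (1 - \<theta>) *\<^sub>R x k) = f k)"

text \<open>\<open>(I + \<Delta>t (1 - \<theta>) B) x = g\<close>, where \<open>(1 - \<theta>) B\<close> is the zero operator on all of \<open>H\<close> if \<open>\<theta> = 1\<close>.\<close>

definition shifted_start ::
  "real \<Rightarrow> real \<Rightarrow> 'h::real_vector set \<Rightarrow> ('h \<Rightarrow> 'h) \<Rightarrow> 'h \<Rightarrow> 'h \<Rightarrow> bool" where
  "shifted_start \<theta> dt D B g x \<longleftrightarrow>
     (1 - \<theta>) *\<^sub>R x \<in> D \<and> x + dt *\<^sub>R B ((1 - \<theta>) *\<^sub>R x) = g"

end

theory Submission
  imports Defs
begin

text \<open>
  The formula is Duhamel's principle for the \<open>\<theta>\<close>-scheme. The scheme with \<open>B = A + C\<close> is linear,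
  so it suffices to know its response to a source \<open>g\<close> that acts in the single step \<open>l\<close>. That
  response is \<open>\<Delta>t x\<^sub>k\<^sub>-\<^sub>l\<close> for \<open>k > l\<close> and \<open>0\<close> for \<open>k \<le> l\<close>, where \<open>x\<close> solves the homogeneous scheme:
  away from step \<open>l\<close> this is clear, and in step \<open>l\<close> the sequence jumps from \<open>0\<close>, and not from
  \<open>\<Delta>t x\<^sub>0\<close>, to \<open>\<Delta>t x\<^sub>1\<close>. The shifted initial condition \<open>(I + \<Delta>t (1 - \<theta>) B) x\<^sub>0 = g\<close> is exactly
  what makes this jump produce the source \<open>g\<close> (lemma \<open>theta_scheme_impulse_response\<close>). Summing the
  responses with the coefficients of the source gives the discrete convolution (lemma
  \<open>theta_scheme_convolution\<close>), and since the scheme determines its solution, the sum of \<open>r\<close> and the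
  two convolutions is \<open>d\<^sup>(\<^sup>2\<^sup>)\<close>.

  The linearity of \<open>B\<close> on its domain has to be extracted from the definition of \<open>N\<^sub>y\<close> as a
  pointwise multiplication: an element of \<open>H\<close> is determined by its representatives up to null
  sets, and representatives combine linearly almost everywhere.
\<close>

section \<open>Linearity of the operator\<close>

lemma superposition_deriv_eqI:
  assumes "function_space \<Omega> \<rho>"
    and "AE x in \<Omega>. \<rho> g x = poly (pderiv p) (\<rho> q x) * \<rho> h x"
  shows "superposition_deriv \<Omega> \<rho> p q h = g"
  unfolding superposition_deriv_def
proof (rule the_equality)
  show "AE x in \<Omega>. \<rho> g x = poly (pderiv p) (\<rho> q x) * \<rho> h x"
    by (rule assms(2))
next
  fix g' assume "AE x in \<Omega>. \<rho> g' x = poly (pderiv p) (\<rho> q x) * \<rho> h x"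
  with assms(2) have "AE x in \<Omega>. \<rho> g' x = \<rho> g x"
    by eventually_elim simp
  then show "g' = g"
    using assms(1) by (auto simp: function_space_def)
qed

lemma superposition_deriv_representative:
  assumes "function_space \<Omega> \<rho>" "h \<in> superposition_deriv_dom \<Omega> \<rho> p q"
  shows "AE x in \<Omega>. \<rho> (superposition_deriv \<Omega> \<rho> p q h) x = poly (pderiv p) (\<rho> q x) * \<rho> h x"
proof -
  obtain g where g: "AE x in \<Omega>. \<rho> g x = poly (pderiv p) (\<rho> q x) * \<rho> h x"
    using assms(2) by (auto simp: superposition_deriv_dom_def)
  then show ?thesis
    by (simp add: superposition_deriv_eqI[OF assms(1) g])
qed

lemma linear_operator_superposition_deriv:
  assumes fs: "function_space \<Omega> \<rho>"
  shows "linear_operator (superposition_deriv_dom \<Omega> \<rho> p q) (superposition_deriv \<Omega> \<rho> p q)"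
proof -
  let ?D = "superposition_deriv_dom \<Omega> \<rho> p q"
  let ?N = "superposition_deriv \<Omega> \<rho> p q"
  have comb: "AE x in \<Omega>. \<rho> (a *\<^sub>R ?N g + b *\<^sub>R ?N h) x
      = poly (pderiv p) (\<rho> q x) * \<rho> (a *\<^sub>R g + b *\<^sub>R h) x"
    if "g \<in> ?D" "h \<in> ?D" for a b g h
  proof -
    have "AE x in \<Omega>. \<rho> (a *\<^sub>R ?N g + b *\<^sub>R ?N h) x = a * \<rho> (?N g) x + b * \<rho> (?N h) x"
      "AE x in \<Omega>. \<rho> (a *\<^sub>R g + b *\<^sub>R h) x = a * \<rho> g x + b * \<rho> h x"
      using fs by (auto simp: function_space_def)
    then show ?thesis
      using superposition_deriv_representative[OF fs that(1)]
        superposition_deriv_representative[OF fs that(2)]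
      by eventually_elim (simp add: algebra_simps)
  qed
  have in_dom: "a *\<^sub>R g + b *\<^sub>R h \<in> ?D" if "g \<in> ?D" "h \<in> ?D" for a b g h
    using comb[OF that] unfolding superposition_deriv_dom_def by blast
  have "AE x in \<Omega>. \<rho> (0 *\<^sub>R 0 + 0 *\<^sub>R 0) x = 0 * \<rho> 0 x + 0 * \<rho> 0 x"
    using fs unfolding function_space_def by blast
  then have "AE x in \<Omega>. \<rho> 0 x = poly (pderiv p) (\<rho> q x) * \<rho> 0 x"
    by eventually_elim simp
  then have "0 \<in> ?D"
    unfolding superposition_deriv_dom_def by blast
  then have "subspace ?D"
    using in_dom[where a = 1 and b = 1] in_dom[where b = 0]
    by (auto simp: subspace_def)
  then show ?thesis
    using superposition_deriv_eqI[OF fs comb] by (simp add: linear_operator_def)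
qed

lemma linear_operator_diff:
  assumes "linear_operator D A" "linear_operator D' B"
  shows "linear_operator (D \<inter> D') (\<lambda>x. A x - B x)"
  using assms by (auto simp: linear_operator_def subspace_inter algebra_simps)

lemma linear_operator_zero:
  assumes "linear_operator D B"
  shows "B 0 = 0"
proof -
  have "0 \<in> D"
    using assms by (simp add: linear_operator_def subspace_0)
  then have "B (0 *\<^sub>R 0 + 0 *\<^sub>R 0) = 0 *\<^sub>R B 0 + 0 *\<^sub>R B 0"
    using assms unfolding linear_operator_def by blast
  then show ?thesis by simp
qed

lemma linear_operator_combination:
  assumes "linear_operator D B" "x \<in> D" "y \<in> D"
  shows "a *\<^sub>R x + b *\<^sub>R y \<in> D" "B (a *\<^sub>R x + b *\<^sub>R y) = a *\<^sub>R B x + b *\<^sub>R B y"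
  using assms by (auto simp: linear_operator_def intro: subspace_add subspace_scale)

section \<open>Superposition of solutions of the scheme\<close>

lemma theta_scheme_cong:
  assumes "\<And>k. k < K \<Longrightarrow> f k = g k" "\<And>k. k \<le> K \<Longrightarrow> x k = y k"
  shows "theta_scheme \<theta> dt K D B f x \<longleftrightarrow> theta_scheme \<theta> dt K D B g y"
  using assms by (simp add: theta_scheme_def)

lemma theta_scheme_add_scaleR:
  assumes B: "linear_operator D B"
    and x: "theta_scheme \<theta> dt K D B f x" and y: "theta_scheme \<theta> dt K D B g y"
  shows "theta_scheme \<theta> dt K D B (\<lambda>k. f k + a *\<^sub>R g k) (\<lambda>k. x k + a *\<^sub>R y k)"
  unfolding theta_scheme_def
proof (intro allI impI)
  fix k assume "k < K"
  let ?X = "\<theta> *\<^sub>R x (Suc k) + (1 - \<theta>) *\<^sub>R x k" and ?Y = "\<theta> *\<^sub>R y (Suc k) + (1 - \<theta>) *\<^sub>R y k"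
  let ?Z = "\<theta> *\<^sub>R (x (Suc k) + a *\<^sub>R y (Suc k)) + (1 - \<theta>) *\<^sub>R (x k + a *\<^sub>R y k)"
  have X: "?X \<in> D" "(x (Suc k) - x k) /\<^sub>R dt - B ?X = f k"
    and Y: "?Y \<in> D" "(y (Suc k) - y k) /\<^sub>R dt - B ?Y = g k"
    using x y \<open>k < K\<close> by (auto simp: theta_scheme_def)
  have Z: "?Z = 1 *\<^sub>R ?X + a *\<^sub>R ?Y"
    by (simp add: algebra_simps)
  have "?Z \<in> D" "B ?Z = B ?X + a *\<^sub>R B ?Y"
    unfolding Z using linear_operator_combination[OF B X(1) Y(1), of 1 a] by simp_all
  moreover have "(x (Suc k) + a *\<^sub>R y (Suc k) - (x k + a *\<^sub>R y k)) /\<^sub>R dt - (B ?X + a *\<^sub>R B ?Y)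
      = f k + a *\<^sub>R g k"
    unfolding X(2)[symmetric] Y(2)[symmetric] by (simp add: algebra_simps)
  ultimately show "?Z \<in> D
      \<and> (x (Suc k) + a *\<^sub>R y (Suc k) - (x k + a *\<^sub>R y k)) /\<^sub>R dt - B ?Z = f k + a *\<^sub>R g k"
    by simp
qed

lemma theta_scheme_add_sum:
  assumes "linear_operator D B" "finite I" "theta_scheme \<theta> dt K D B f x"
    and "\<And>i. i \<in> I \<Longrightarrow> theta_scheme \<theta> dt K D B (g i) (y i)"
  shows "theta_scheme \<theta> dt K D B (\<lambda>k. f k + (\<Sum>i\<in>I. a i *\<^sub>R g i k)) (\<lambda>k. x k + (\<Sum>i\<in>I. a i *\<^sub>R y i k))"
  using assms(2,4)
proof (induction I rule: finite_induct)
  case empty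
  then show ?case using assms(3) by simp
next
  case (insert i I)
  then have "theta_scheme \<theta> dt K D B
      (\<lambda>k. f k + (\<Sum>i\<in>I. a i *\<^sub>R g i k) + a i *\<^sub>R g i k)
      (\<lambda>k. x k + (\<Sum>i\<in>I. a i *\<^sub>R y i k) + a i *\<^sub>R y i k)"
    by (intro theta_scheme_add_scaleR[OF assms(1)]) auto
  then show ?case
    using insert.hyps by (simp add: add_ac)
qed

section \<open>Impulse responses and discrete convolution\<close>

text \<open>
  Up to the factor \<open>\<Delta>t\<close>, in step \<open>l\<close> the scheme sees only \<open>\<theta> x\<^sub>1\<close> in place of \<open>\<theta> x\<^sub>1 + (1 - \<theta>) x\<^sub>0\<close> under \<open>B\<close>, and
  only \<open>x\<^sub>1\<close> in place of \<open>x\<^sub>1 - x\<^sub>0\<close> in the difference quotient. The homogeneous equation therefore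
  fails there by \<open>x\<^sub>0 + \<Delta>t B((1 - \<theta>) x\<^sub>0)\<close>, which is \<open>g\<close>. The start condition also supplies
  \<open>(1 - \<theta>) x\<^sub>0 \<in> D\<close>, without which \<open>\<theta> x\<^sub>1\<close> need not be in the domain.
\<close>

lemma theta_scheme_impulse_response:
  assumes B: "linear_operator D B" and dt: "dt \<noteq> 0"
    and x: "theta_scheme \<theta> dt K D B (\<lambda>k. 0) x" and x0: "shifted_start \<theta> dt D B g (x 0)"
  shows "theta_scheme \<theta> dt K D B (\<lambda>k. if k = l then g else 0)
           (\<lambda>k. if l < k then dt *\<^sub>R x (k - l) else 0)"
    (is "theta_scheme _ _ _ _ _ _ ?y")
  unfolding theta_scheme_def
proof (intro allI impI)
  fix k assume k: "k < K"
  let ?Y = "\<theta> *\<^sub>R ?y (Suc k) + (1 - \<theta>) *\<^sub>R ?y k"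
  have step: "\<theta> *\<^sub>R x (Suc j) + (1 - \<theta>) *\<^sub>R x j \<in> D"
      "B (\<theta> *\<^sub>R x (Suc j) + (1 - \<theta>) *\<^sub>R x j) = (x (Suc j) - x j) /\<^sub>R dt" if "j < K" for j
    using x that by (auto simp: theta_scheme_def)
  consider "k < l" | "k = l" | "l < k" by linarith
  then show "?Y \<in> D \<and> (?y (Suc k) - ?y k) /\<^sub>R dt - B ?Y = (if k = l then g else 0)"
  proof cases
    case 1
    then show ?thesis
      using B linear_operator_zero[OF B] by (simp add: linear_operator_def subspace_0)
  next
    case 2
    let ?X = "\<theta> *\<^sub>R x (Suc 0) + (1 - \<theta>) *\<^sub>R x 0"
    have X: "?X \<in> D" "B ?X = (x (Suc 0) - x 0) /\<^sub>R dt"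
      using step[of 0] k by auto
    have S: "(1 - \<theta>) *\<^sub>R x 0 \<in> D" "x 0 + dt *\<^sub>R B ((1 - \<theta>) *\<^sub>R x 0) = g"
      using x0 by (auto simp: shifted_start_def)
    have Y: "?Y = dt *\<^sub>R ?X + (- dt) *\<^sub>R ((1 - \<theta>) *\<^sub>R x 0)"
      using 2 by (simp add: algebra_simps)
    have "?Y \<in> D" "B ?Y = dt *\<^sub>R B ?X - dt *\<^sub>R B ((1 - \<theta>) *\<^sub>R x 0)"
      unfolding Y using linear_operator_combination[OF B X(1) S(1), of dt "- dt"] by simp_all
    moreover have "(?y (Suc k) - ?y k) /\<^sub>R dt = x (Suc 0)"
      using 2 dt by simp
    moreover have "x (Suc 0) - (dt *\<^sub>R B ?X - dt *\<^sub>R B ((1 - \<theta>) *\<^sub>R x 0)) = g"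
      unfolding X(2) S(2)[symmetric] using dt by simp
    ultimately show ?thesis
      using 2 by simp
  next
    case 3
    let ?X = "\<theta> *\<^sub>R x (Suc (k - l)) + (1 - \<theta>) *\<^sub>R x (k - l)"
    have X: "?X \<in> D" "B ?X = (x (Suc (k - l)) - x (k - l)) /\<^sub>R dt"
      using step[of "k - l"] k by auto
    have Y: "?Y = dt *\<^sub>R ?X + 0 *\<^sub>R ?X"
      using 3 by (simp add: Suc_diff_le algebra_simps)
    have "?Y \<in> D" "B ?Y = dt *\<^sub>R B ?X"
      unfolding Y using linear_operator_combination[OF B X(1) X(1), of dt 0] by simp_all
    then show ?thesis
      using 3 dt by (simp add: X(2) Suc_diff_le flip: scaleR_diff_right)
  qed
qed

text \<open>
  The source \<open>\<Sum>\<^sub>i a\<^sub>i\<^sub>k g\<^sub>i\<close> is a combination of impulses, one for each pair of a direction \<open>g\<^sub>i\<close> and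
  a step \<open>l < K\<close>. At time \<open>k \<le> K\<close> only the impulses with \<open>l < k\<close> have been felt, which truncates
  the inner sum at \<open>k\<close>.
\<close>

lemma theta_scheme_convolution:
  assumes B: "linear_operator D B" and dt: "dt \<noteq> 0" and I: "finite I"
    and x: "theta_scheme \<theta> dt K D B f x"
    and b: "\<And>i. i \<in> I \<Longrightarrow> theta_scheme \<theta> dt K D B (\<lambda>k. 0) (b i)"
    and b0: "\<And>i. i \<in> I \<Longrightarrow> shifted_start \<theta> dt D B (g i) (b i 0)"
  shows "theta_scheme \<theta> dt K D B (\<lambda>k. f k + (\<Sum>i\<in>I. a i k *\<^sub>R g i))
           (\<lambda>k. x k + dt *\<^sub>R (\<Sum>i\<in>I. \<Sum>l<k. a i l *\<^sub>R b i (k - l)))"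
proof -
  let ?g = "\<lambda>(i, l) k. if k = l then g i else 0"
  let ?y = "\<lambda>(i, l) k. if l < k then dt *\<^sub>R b i (k - l) else 0"
  let ?J = "I \<times> {..<K}"
  have "theta_scheme \<theta> dt K D B
      (\<lambda>k. f k + (\<Sum>j\<in>?J. (case j of (i, l) \<Rightarrow> a i l) *\<^sub>R ?g j k))
      (\<lambda>k. x k + (\<Sum>j\<in>?J. (case j of (i, l) \<Rightarrow> a i l) *\<^sub>R ?y j k))"
    using I by (intro theta_scheme_add_sum[OF B _ x])
      (auto intro!: theta_scheme_impulse_response[OF B dt b b0])
  moreover have "(\<Sum>j\<in>?J. (case j of (i, l) \<Rightarrow> a i l) *\<^sub>R ?g j k) = (\<Sum>i\<in>I. a i k *\<^sub>R g i)"
    if "k < K" for k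
  proof -
    have "(\<Sum>l<K. a i l *\<^sub>R (if k = l then g i else 0)) = a i k *\<^sub>R g i" for i
      using that by (simp add: if_distrib[of "scaleR _"] sum.delta' cong: if_cong)
    then have "(\<Sum>i\<in>I. a i k *\<^sub>R g i) = (\<Sum>i\<in>I. \<Sum>l<K. a i l *\<^sub>R (if k = l then g i else 0))"
      by simp
    also have "\<dots> = (\<Sum>j\<in>?J. (case j of (i, l) \<Rightarrow> a i l) *\<^sub>R ?g j k)"
      unfolding sum.cartesian_product by (intro sum.cong) auto
    finally show ?thesis by simp
  qed
  moreover have "(\<Sum>j\<in>?J. (case j of (i, l) \<Rightarrow> a i l) *\<^sub>R ?y j k)
      = dt *\<^sub>R (\<Sum>i\<in>I. \<Sum>l<k. a i l *\<^sub>R b i (k - l))" if "k \<le> K" for k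
  proof -
    have "(\<Sum>l<K. a i l *\<^sub>R (if l < k then dt *\<^sub>R b i (k - l) else 0))
        = dt *\<^sub>R (\<Sum>l<k. a i l *\<^sub>R b i (k - l))" for i
      unfolding scaleR_sum_right using that
      by (intro sum.mono_neutral_cong_right) (auto simp: mult.commute)
    then have "dt *\<^sub>R (\<Sum>i\<in>I. \<Sum>l<k. a i l *\<^sub>R b i (k - l))
        = (\<Sum>i\<in>I. \<Sum>l<K. a i l *\<^sub>R (if l < k then dt *\<^sub>R b i (k - l) else 0))"
      by (simp only: scaleR_sum_right)
    also have "\<dots> = (\<Sum>j\<in>?J. (case j of (i, l) \<Rightarrow> a i l) *\<^sub>R ?y j k)"
      unfolding sum.cartesian_product by (intro sum.cong) auto
    finally show ?thesis by simp
  qed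
  ultimately show ?thesis
    by (simp cong: theta_scheme_cong)
qed

lemma convolution_in_span:
  fixes b :: "'i \<Rightarrow> nat \<Rightarrow> 'a::real_vector"
  assumes "(\<Union>i\<in>I. b i ` {1..k}) \<subseteq> S"
  shows "(\<Sum>i\<in>I. \<Sum>l<k. a i l *\<^sub>R b i (k - l)) \<in> span S"
proof -
  have "b i (k - l) \<in> S" if "i \<in> I" "l < k" for i l
    using assms that by (force intro: imageI)
  then show ?thesis
    by (intro span_sum span_scale span_base) auto
qed

section \<open>The second Newton step\<close>

theorem proposition3p19:
  fixes T :: real
    and iVW :: "'v::{real_inner, complete_space} \<Rightarrow> 'w::{real_inner, complete_space}"
    and iWH :: "'w \<Rightarrow> 'h::{real_inner, complete_space}"
    and \<Omega> :: "'x measure" and \<rho> :: "'h \<Rightarrow> 'x \<Rightarrow> real"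
    and domA :: "'h set" and A :: "'h \<Rightarrow> 'h"
    and p :: "real poly"
    and y0 :: 'w and F :: 'h
    and tr :: "'y::banach \<Rightarrow> real \<Rightarrow> 'h"
    and uL :: "'u::{real_inner, complete_space} \<Rightarrow> real \<Rightarrow> real"
    and zL :: "'z::banach \<Rightarrow> real \<Rightarrow> 'h" and zW :: "'z \<Rightarrow> 'w"
    and E :: "'y \<times> 'u \<Rightarrow> 'z"
    and ybar :: 'y and ybar0 :: 'v
    and domC D :: "'h set" and C :: "'h \<Rightarrow> 'h" and Nbar :: 'h
    and n m K :: nat and \<psi> :: "nat \<Rightarrow> 'w" and c :: "nat \<Rightarrow> 'h"
    and \<theta> dt :: real and t :: "nat \<Rightarrow> real"
    and u v :: "nat \<Rightarrow> nat \<Rightarrow> real"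
    and \<beta> \<gamma> :: "nat \<Rightarrow> nat \<Rightarrow> 'h" and r d :: "nat \<Rightarrow> 'h"
  assumes setting: "newton_setting T iVW iWH \<Omega> \<rho> domA A p y0 F tr uL zL zW E"
    and ybar: "\<forall>s\<in>{0..T}. tr ybar s = iWH (iVW ybar0)"
    and Nbar: "Nbar = superposition \<Omega> \<rho> p (iWH (iVW ybar0))"
    and domC: "domC = superposition_deriv_dom \<Omega> \<rho> p (iWH (iVW ybar0))"
    and C: "C = (\<lambda>h. - superposition_deriv \<Omega> \<rho> p (iWH (iVW ybar0)) h)"
    and D: "D = domA \<inter> domC"
    and \<psi>: "orthonormal_upto n \<psi>" "\<forall>i\<in>{1..n}. iWH (\<psi> i) \<in> domC"
    and c: "orthonormal_upto m c"
    and \<theta>: "\<theta> \<in> {1/2..1}"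
    and grid: "t 0 = 0" "t K = T" "\<forall>k<K. t k < t (Suc k)" "\<forall>k<K. t (Suc k) - t k = dt"
    and \<beta>: "\<forall>i\<in>{1..n}. theta_scheme \<theta> dt K D (\<lambda>x. A x + C x) (\<lambda>k. 0) (\<beta> i) \<and>
              shifted_start \<theta> dt D (\<lambda>x. A x + C x) (- C (iWH (\<psi> i))) (\<beta> i 0)"
    and \<gamma>: "\<forall>j\<in>{1..m}. theta_scheme \<theta> dt K D (\<lambda>x. A x + C x) (\<lambda>k. 0) (\<gamma> j) \<and>
              shifted_start \<theta> dt D (\<lambda>x. A x + C x) (- c j) (\<gamma> j 0)"
    and r: "theta_scheme \<theta> dt K D (\<lambda>x. A x + C x) (\<lambda>k. Nbar) r" "r 0 = 0"
    and d: "theta_scheme \<theta> dt K D (\<lambda>x. A x + C x)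
              (\<lambda>k. Nbar - (\<Sum>i=1..n. u i k *\<^sub>R C (iWH (\<psi> i))) - (\<Sum>j=1..m. v j k *\<^sub>R c j)) d"
           "d 0 = 0"
    and d_unique: "\<And>d'. \<lbrakk>theta_scheme \<theta> dt K D (\<lambda>x. A x + C x)
              (\<lambda>k. Nbar - (\<Sum>i=1..n. u i k *\<^sub>R C (iWH (\<psi> i))) - (\<Sum>j=1..m. v j k *\<^sub>R c j)) d';
              d' 0 = 0\<rbrakk> \<Longrightarrow> \<forall>k\<le>K. d' k = d k"
  shows "(\<forall>k\<le>K. d k = r k
            + dt *\<^sub>R (\<Sum>i=1..n. \<Sum>l<k. u i l *\<^sub>R \<beta> i (k - l))
            + dt *\<^sub>R (\<Sum>j=1..m. \<Sum>l<k. v j l *\<^sub>R \<gamma> j (k - l)))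
       \<and> (\<forall>k\<le>K. d k - r k \<in>
            span ((\<Union>i\<in>{1..n}. \<beta> i ` {1..k}) \<union> (\<Union>j\<in>{1..m}. \<gamma> j ` {1..k})))"
proof (intro conjI)
  interpret newton_setting T iVW iWH \<Omega> \<rho> domA A p y0 F tr uL zL zW E
    by (rule setting)
  let ?B = "\<lambda>x. A x + C x"
  let ?d = "\<lambda>k. r k + dt *\<^sub>R (\<Sum>i=1..n. \<Sum>l<k. u i l *\<^sub>R \<beta> i (k - l))
                   + dt *\<^sub>R (\<Sum>j=1..m. \<Sum>l<k. v j l *\<^sub>R \<gamma> j (k - l))"
  have B: "linear_operator D ?B"
    using linear_operator_diff[OF A_linear linear_operator_superposition_deriv[OF H_functions]]
    by (simp add: D domC C)
  \<comment> \<open>A grid without steps would leave \<open>\<Delta>t\<close> arbitrary, possibly zero.\<close>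
  have "0 < K"
    using T_pos grid(1,2) by (cases K) auto
  then have dt: "dt \<noteq> 0"
    using grid(3,4) by force
  have "theta_scheme \<theta> dt K D ?B
      (\<lambda>k. Nbar + (\<Sum>i=1..n. u i k *\<^sub>R (- C (iWH (\<psi> i)))) + (\<Sum>j=1..m. v j k *\<^sub>R (- c j))) ?d"
    using \<beta> \<gamma> by (intro theta_scheme_convolution[OF B dt] r(1)) auto
  then have "theta_scheme \<theta> dt K D ?B
      (\<lambda>k. Nbar - (\<Sum>i=1..n. u i k *\<^sub>R C (iWH (\<psi> i))) - (\<Sum>j=1..m. v j k *\<^sub>R c j)) ?d"
    by (simp add: sum_negf)
  moreover have "?d 0 = 0"
    using r(2) by simp
  ultimately have "\<forall>k\<le>K. ?d k = d k"
    by (rule d_unique)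
  then show formula: "\<forall>k\<le>K. d k = ?d k"
    by simp
  show "\<forall>k\<le>K. d k - r k \<in>
      span ((\<Union>i\<in>{1..n}. \<beta> i ` {1..k}) \<union> (\<Union>j\<in>{1..m}. \<gamma> j ` {1..k}))"
  proof (intro allI impI)
    fix k assume "k \<le> K"
    then have "d k - r k = dt *\<^sub>R (\<Sum>i=1..n. \<Sum>l<k. u i l *\<^sub>R \<beta> i (k - l))
                         + dt *\<^sub>R (\<Sum>j=1..m. \<Sum>l<k. v j l *\<^sub>R \<gamma> j (k - l))"
      using formula by simp
    also have "\<dots> \<in> span ((\<Union>i\<in>{1..n}. \<beta> i ` {1..k}) \<union> (\<Union>j\<in>{1..m}. \<gamma> j ` {1..k}))"
      by (intro span_add span_scale convolution_in_span) auto
    finally show "d k - r k \<in>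
        span ((\<Union>i\<in>{1..n}. \<beta> i ` {1..k}) \<union> (\<Union>j\<in>{1..m}. \<gamma> j ` {1..k}))" .
  qed
qed

end
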